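(* For every instance $G$ of the battery charging game with $T=2$ time steps and every price profile $\mathbf{p}=(p_1,p_2)\in\mathbb{R}^2$, there exists a Nash equilibrium for $\mathbf{p}$.
   Context: **Battery charging game.** An instance consists of: a number of time steps $T\in\mathbb{N}$, with $[T]=\{1,\dots,T\}$; a finite directed graph $H=(V,E)$; for each $t\in[T]$ a copy $H_t=(V_t,E_t)$ of $H$ (the copy of $v\in V$ is $v_t$); a capacity $\kappa(e_t)\ge 0$ for each $e_t\in E_t$; a value $d(v_t)\in\mathbb{R}$ for each $v_t\in V_t$ (positive: supply, negative: demand); a finite set $B$ of battery agents, each $b\in B$ having a location $v^b\in V$, battery nodes $b_1,\dots,b_T$, and battery edges $(b_t,b_{t+1})$, $t\in[T-1]$, with capacities $\kappa((b_t,b_{t+1}))\ge 0$. For each $b,t$ there are two transaction edges $(b_t,v^b_t)$ and $(v^b_t,b_t)$ (with infinite capacity under $\kappa$). The graph $G$ is the union of all $H_t$, all battery nodes, battery edges and transaction edges. In addition there is a source $x$ with edges $(x,v_t)$ of capacity $\max(0,d(v_t))$ and a target $y$ with edges $(v_t,y)$ of capacity $\max(0,-d(v_t))$, for all $v_t\in V_t$, $t\in[T]$. **Strategies.** A strategy of agent $b$ is a vector $s_b=(s_{b,t})_{t\in[T]}\in\mathbb{R}^{[T]}$ (positive entries: charging, negative: discharging) with $0\le\sum_{z=1}^t s_{b,z}\le\kappa((b_t,b_{t+1}))$ for each $t\in[T-1]$. A strategy profile $\mathbf{s}$ consists of one strategy per agent. **Flow.** Given $\mathbf{s}$, $\kappa_{\mathbf{s}}$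 is defined by $\kappa_{\mathbf{s}}((v^b_t,b_t))=\max(0,s_{b,t})$, $\kappa_{\mathbf{s}}((b_t,v^b_t))=\max(0,-s_{b,t})$, and $\kappa_{\mathbf{s}}=\kappa$ on all other edges; $G_{\mathbf{s}}$ is the graph $G$ (with $x,y$) with capacities $\kappa_{\mathbf{s}}$. Flows are (real-valued) feasible $x$-$y$-flows, the value $|f|$ being the flow out of $x$; a maximum flow is one of maximum value. **Admissibility.** A transaction edge $e$ is admissible for $\mathbf{s}$ if every maximum flow $f$ in $G_{\mathbf{s}}$ saturates it, i.e. $f(e)=\kappa_{\mathbf{s}}(e)$. A strategy $s_b$ is admissible for $\mathbf{s}$ if all transaction edges of agent $b$ are admissible; $\mathbf{s}$ is admissible if all its strategies are. **Utilities.** For a price profile $\mathbf{p}=(p_t)_{t\in[T]}\in\mathbb{R}^{[T]}$, $u_b(\mathbf{s},\mathbf{p})=-\infty$ if $s_b$ is not admissible for $\mathbf{s}$, and $u_b(\mathbf{s},\mathbf{p})=-\sum_{t\in[T]}s_{b,t}p_t$ otherwise. **Nash equilibrium.** $\mathbf{s}$ is a (pure) Nash equilibrium for $\mathbf{p}$ if there is no agent $b$ with a strategy $s'_b$ such that $u_b((s'_b,\mathbf{s}_{-b}),\mathbf{p})>u_b(\mathbf{s},\mathbf{p})$. *)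

theory Defs
  imports
    "Graph_Theory.Pair_Digraph"
    "HOL-Library.Extended_Real"
begin

section \<open>Flows in digraphs with extended real capacities\<close>

definition is_flow ::
  "('n, 'e) pre_digraph \<Rightarrow> ('e \<Rightarrow> ereal) \<Rightarrow> 'n \<Rightarrow> 'n \<Rightarrow> ('e \<Rightarrow> real) \<Rightarrow> bool" where
  "is_flow G c x y f \<longleftrightarrow>
     (\<forall>e \<in> arcs G. 0 \<le> f e \<and> ereal (f e) \<le> c e) \<and>
     (\<forall>v \<in> verts G - {x, y}. (\<Sum>e \<in> in_arcs G v. f e) = (\<Sum>e \<in> out_arcs G v. f e))"

(* This is the net outflow of x only if no arc enters x, as in the networks used below. *)
definition flow_value :: "('n, 'e) pre_digraph \<Rightarrow> 'n \<Rightarrow> ('e \<Rightarrow> real) \<Rightarrow> real" where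
  "flow_value G x f = (\<Sum>e \<in> out_arcs G x. f e)"

definition is_max_flow ::
  "('n, 'e) pre_digraph \<Rightarrow> ('e \<Rightarrow> ereal) \<Rightarrow> 'n \<Rightarrow> 'n \<Rightarrow> ('e \<Rightarrow> real) \<Rightarrow> bool" where
  "is_max_flow G c x y f \<longleftrightarrow>
     is_flow G c x y f \<and> (\<forall>g. is_flow G c x y g \<longrightarrow> flow_value G x g \<le> flow_value G x f)"


section \<open>Instances of the battery charging game\<close>

(* grid_cap I t e is the capacity of the copy e_t, node_val I t v the value d(v_t), and
   bat_cap I b t the capacity of the battery edge (b_t, b_(t+1)). *)
record ('v, 'b) battery_inst =
  steps :: nat
  base_graph :: "'v pair_pre_digraph"
  grid_cap :: "nat \<Rightarrow> 'v \<times> 'v \<Rightarrow> real"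
  node_val :: "nat \<Rightarrow> 'v \<Rightarrow> real"
  agents :: "'b set"
  location :: "'b \<Rightarrow> 'v"
  bat_cap :: "'b \<Rightarrow> nat \<Rightarrow> real"

definition battery_instance :: "('v, 'b) battery_inst \<Rightarrow> bool" where
  "battery_instance I \<longleftrightarrow>
     pair_fin_digraph (base_graph I) \<and>
     (\<forall>t \<in> {1..steps I}. \<forall>e \<in> parcs (base_graph I). 0 \<le> grid_cap I t e) \<and>
     finite (agents I) \<and>
     (\<forall>b \<in> agents I. location I b \<in> pverts (base_graph I)) \<and>
     (\<forall>b \<in> agents I. \<forall>t \<in> {1..<steps I}. 0 \<le> bat_cap I b t)"

datatype ('v, 'b) node =
    Source
  | Target
  | Grid_Node nat 'v
  | Bat_Node 'b nat

(* Arcs are named by their role; game_tail and game_head give their end points.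
   No two arcs of the same network have the same tail and head. *)
datatype ('v, 'b) arc =
    Source_Arc nat 'v
  | Target_Arc nat 'v
  | Grid_Arc nat "'v \<times> 'v"
  | Bat_Arc 'b nat
  | Charge_Arc 'b nat
  | Discharge_Arc 'b nat

fun game_tail :: "('v, 'b) battery_inst \<Rightarrow> ('v, 'b) arc \<Rightarrow> ('v, 'b) node" where
  "game_tail I (Source_Arc t v) = Source"
| "game_tail I (Target_Arc t v) = Grid_Node t v"
| "game_tail I (Grid_Arc t e) = Grid_Node t (fst e)"
| "game_tail I (Bat_Arc b t) = Bat_Node b t"
| "game_tail I (Charge_Arc b t) = Grid_Node t (location I b)"
| "game_tail I (Discharge_Arc b t) = Bat_Node b t"

fun game_head :: "('v, 'b) battery_inst \<Rightarrow> ('v, 'b) arc \<Rightarrow> ('v, 'b) node" where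
  "game_head I (Source_Arc t v) = Grid_Node t v"
| "game_head I (Target_Arc t v) = Target"
| "game_head I (Grid_Arc t e) = Grid_Node t (snd e)"
| "game_head I (Bat_Arc b t) = Bat_Node b (Suc t)"
| "game_head I (Charge_Arc b t) = Bat_Node b t"
| "game_head I (Discharge_Arc b t) = Grid_Node t (location I b)"

definition game_graph ::
  "('v, 'b) battery_inst \<Rightarrow> (('v, 'b) node, ('v, 'b) arc) pre_digraph" where
  "game_graph I =
     \<lparr> verts = {Source, Target}
         \<union> {Grid_Node t v |t v. t \<in> {1..steps I} \<and> v \<in> pverts (base_graph I)}
         \<union> {Bat_Node b t |b t. b \<in> agents I \<and> t \<in> {1..steps I}},
       arcs = {Source_Arc t v |t v. t \<in> {1..steps I} \<and> v \<in> pverts (base_graph I)}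
         \<union> {Target_Arc t v |t v. t \<in> {1..steps I} \<and> v \<in> pverts (base_graph I)}
         \<union> {Grid_Arc t e |t e. t \<in> {1..steps I} \<and> e \<in> parcs (base_graph I)}
         \<union> {Bat_Arc b t |b t. b \<in> agents I \<and> t \<in> {1..<steps I}}
         \<union> {Charge_Arc b t |b t. b \<in> agents I \<and> t \<in> {1..steps I}}
         \<union> {Discharge_Arc b t |b t. b \<in> agents I \<and> t \<in> {1..steps I}},
       tail = game_tail I,
       head = game_head I \<rparr>"

fun base_cap :: "('v, 'b) battery_inst \<Rightarrow> ('v, 'b) arc \<Rightarrow> ereal" where
  "base_cap I (Source_Arc t v) = ereal (max 0 (node_val I t v))"
| "base_cap I (Target_Arc t v) = ereal (max 0 (- node_val I t v))"
| "base_cap I (Grid_Arc t e) = ereal (grid_cap I t e)"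
| "base_cap I (Bat_Arc b t) = ereal (bat_cap I b t)"
| "base_cap I (Charge_Arc b t) = \<infinity>"
| "base_cap I (Discharge_Arc b t) = \<infinity>"


section \<open>Strategies, admissibility, utilities and equilibria\<close>

(* Vectors and profiles are total functions; only entries for agents of the instance and
   times in {1..steps I} are ever used. *)
type_synonym strategy = "nat \<Rightarrow> real"
type_synonym 'b profile = "'b \<Rightarrow> strategy"
type_synonym prices = "nat \<Rightarrow> real"

(* There is deliberately no condition on the sum over all time steps: for admissible
   strategies, flow conservation forces it to be 0. *)
definition is_strategy :: "('v, 'b) battery_inst \<Rightarrow> 'b \<Rightarrow> strategy \<Rightarrow> bool" where
  "is_strategy I b sb \<longleftrightarrow>
     (\<forall>t \<in> {1..<steps I}. 0 \<le> (\<Sum>z = 1..t. sb z) \<and> (\<Sum>z = 1..t. sb z) \<le> bat_cap I b t)"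

definition is_profile :: "('v, 'b) battery_inst \<Rightarrow> 'b profile \<Rightarrow> bool" where
  "is_profile I s \<longleftrightarrow> (\<forall>b \<in> agents I. is_strategy I b (s b))"

fun profile_cap :: "('v, 'b) battery_inst \<Rightarrow> 'b profile \<Rightarrow> ('v, 'b) arc \<Rightarrow> ereal" where
  "profile_cap I s (Charge_Arc b t) = ereal (max 0 (s b t))"
| "profile_cap I s (Discharge_Arc b t) = ereal (max 0 (- s b t))"
| "profile_cap I s e = base_cap I e"

definition admissible_arc :: "('v, 'b) battery_inst \<Rightarrow> 'b profile \<Rightarrow> ('v, 'b) arc \<Rightarrow> bool" where
  "admissible_arc I s e \<longleftrightarrow>
     (\<forall>f. is_max_flow (game_graph I) (profile_cap I s) Source Target f
          \<longrightarrow> ereal (f e) = profile_cap I s e)"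

definition admissible_for :: "('v, 'b) battery_inst \<Rightarrow> 'b profile \<Rightarrow> 'b \<Rightarrow> bool" where
  "admissible_for I s b \<longleftrightarrow>
     (\<forall>t \<in> {1..steps I}. admissible_arc I s (Charge_Arc b t) \<and> admissible_arc I s (Discharge_Arc b t))"

definition utility :: "('v, 'b) battery_inst \<Rightarrow> 'b profile \<Rightarrow> prices \<Rightarrow> 'b \<Rightarrow> ereal" where
  "utility I s p b =
     (if admissible_for I s b then ereal (- (\<Sum>t = 1..steps I. s b t * p t)) else -\<infinity>)"

definition nash_equilibrium :: "('v, 'b) battery_inst \<Rightarrow> prices \<Rightarrow> 'b profile \<Rightarrow> bool" where
  "nash_equilibrium I p s \<longleftrightarrow>
     is_profile I s \<and>
     \<not> (\<exists>b \<in> agents I. \<exists>s'. is_strategy I b s' \<and> utility I (s(b := s')) p b > utility I s p b)"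

end

theory Submission
  imports Defs "HOL-Analysis.Function_Topology"
begin

text \<open>For two time steps an admissible agent charges some amount in step 1 and discharges exactly
  that amount in step 2, so its utility is this amount times \<open>p 2 - p 1\<close>. If \<open>p 2 \<le> p 1\<close>, the zero
  profile is an equilibrium. Otherwise let every agent offer its full battery capacity, take a
  maximum flow of the resulting network that moves as little as possible through the batteries,
  and let every agent play the amount moved through its battery. By minimality, every maximum flow
  of the smaller network saturates the transaction arcs; and if an agent offers more, then the
  chosen flow is still maximum but does not saturate that agent's charging arc.\<close>

section \<open>Maximum flows of minimum cost in general networks\<close>

lemma is_flow_cong:
  assumes "\<And>e. e \<in> arcs G \<Longrightarrow> f e = g e"
  shows "is_flow G c x y f \<longleftrightarrow> is_flow G c x y g"
proof -
  have "sum f (in_arcs G v) = sum g (in_arcs G v)" "sum f (out_arcs G v) = sum g (out_arcs G v)" for v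
    by (auto intro!: sum.cong simp: assms in_arcs_def out_arcs_def)
  then show ?thesis by (simp add: is_flow_def assms)
qed

lemma flow_value_cong:
  assumes "\<And>e. e \<in> arcs G \<Longrightarrow> f e = g e"
  shows "flow_value G x f = flow_value G x g"
  by (auto intro!: sum.cong simp: assms flow_value_def out_arcs_def)

lemma is_flow_mono_cap:
  assumes "is_flow G c x y f" "\<And>e. e \<in> arcs G \<Longrightarrow> c e \<le> c' e"
  shows "is_flow G c' x y f"
  using assms order_trans unfolding is_flow_def by blast

lemma continuous_on_sum_coordinates:
  "continuous_on A (\<lambda>f :: 'e \<Rightarrow> real. \<Sum>e\<in>E. w e * f e)"
  by (intro continuous_intros continuous_on_subset
      [OF continuous_on_product_coordinates]) auto

text \<open>Values outside \<open>arcs G\<close> are pinned to 0 so that the flows lie in a product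
  of compact intervals, compact by Tychonoff; conservation cuts out a closed subset.\<close>

lemma compact_flows:
  assumes "\<And>e. e \<in> arcs G \<Longrightarrow> c e = ereal (k e)"
  shows "compact {f. is_flow G c x y f \<and> (\<forall>e. e \<notin> arcs G \<longrightarrow> f e = 0)}" (is "compact ?S")
proof -
  define K where "K e = (if e \<in> arcs G then {0..k e} else {0})" for e
  have "compactin (product_topology (\<lambda>_. euclidean) UNIV) (Pi\<^sub>E UNIV K)"
    unfolding compactin_PiE by (auto simp: K_def)
  then have "compact (Pi\<^sub>E UNIV K)"
    by (simp add: euclidean_product_topology)
  moreover have "closed (\<Inter>v\<in>verts G - {x, y}. {f :: _ \<Rightarrow> real. sum f (in_arcs G v) = sum f (out_arcs G v)})"
    using continuous_on_sum_coordinates[of UNIV "\<lambda>_. 1"]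
    by (intro closed_INT ballI closed_Collect_eq) (simp_all only: mult_1)
  moreover have "?S = Pi\<^sub>E UNIV K \<inter>
      (\<Inter>v\<in>verts G - {x, y}. {f. sum f (in_arcs G v) = sum f (out_arcs G v)})"
    by (auto simp: is_flow_def K_def PiE_def Pi_def assms split: if_splits)
  ultimately show ?thesis by (simp add: compact_Int_closed)
qed

text \<open>Two successive extremal choices: the value attains its maximum on a compact set of
  flows, and the linear cost attains its minimum on the compact set of maximizers.\<close>

lemma min_cost_max_flow_exists:
  fixes G :: "('n, 'e) pre_digraph"
  assumes c: "\<And>e. e \<in> arcs G \<Longrightarrow> c e = ereal (k e)" "\<And>e. e \<in> arcs G \<Longrightarrow> 0 \<le> k e"
  obtains f where "is_max_flow G c x y f"
    and "\<And>g. is_max_flow G c x y g \<Longrightarrow> (\<Sum>e\<in>arcs G. w e * f e) \<le> (\<Sum>e\<in>arcs G. w e * g e)"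
proof -
  define S where "S = {f. is_flow G c x y f \<and> (\<forall>e. e \<notin> arcs G \<longrightarrow> f e = 0)}"
  have S: "compact S" using compact_flows[of G c k] c(1) by (simp add: S_def)
  \<comment> \<open>\<open>n\<close> carries an arbitrary flow into the compact set \<open>S\<close>
    while keeping its value and cost.\<close>
  define n where "n g e = (if e \<in> arcs G then g e else 0)" for g :: "'e \<Rightarrow> real" and e
  have n: "n g \<in> S" if "is_flow G c x y g" for g
    using that is_flow_cong[of G g "n g"] by (simp add: S_def n_def)
  have nv: "flow_value G x (n g) = flow_value G x g" for g
    by (rule flow_value_cong) (simp add: n_def)
  have "(\<lambda>_. 0) \<in> S" by (simp add: S_def is_flow_def c)
  moreover have cont: "continuous_on A (flow_value G x)" for A
    using continuous_on_sum_coordinates[of A "\<lambda>_. 1" "out_arcs G x"]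
    by (simp add: flow_value_def[abs_def])
  ultimately obtain m where m: "m \<in> S" "\<And>g. g \<in> S \<Longrightarrow> flow_value G x g \<le> flow_value G x m"
    using continuous_attains_sup[OF S] by blast
  define M where "M = S \<inter> {f. flow_value G x f = flow_value G x m}"
  have "compact M" unfolding M_def
    by (intro compact_Int_closed S closed_Collect_eq cont continuous_on_const)
  moreover have "m \<in> M" using m by (simp add: M_def)
  ultimately obtain f where f: "f \<in> M"
    "\<And>g. g \<in> M \<Longrightarrow> (\<Sum>e\<in>arcs G. w e * f e) \<le> (\<Sum>e\<in>arcs G. w e * g e)"
    using continuous_attains_inf[OF _ _ continuous_on_sum_coordinates, of M w "arcs G"] by blast
  have fm: "is_max_flow G c x y f"
    unfolding is_max_flow_def using f(1) m(2) n nv by (auto simp: M_def S_def) (metis)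
  show ?thesis
  proof (rule that[OF fm])
    fix g assume g: "is_max_flow G c x y g"
    then have "flow_value G x g = flow_value G x f"
      using fm by (auto simp: is_max_flow_def intro: antisym)
    then have "n g \<in> M" using n[of g] nv[of g] f(1) g by (simp add: M_def is_max_flow_def)
    from f(2)[OF this] show "(\<Sum>e\<in>arcs G. w e * f e) \<le> (\<Sum>e\<in>arcs G. w e * g e)"
      by (simp add: n_def)
  qed
qed

text \<open>Since \<open>f\<close> stays feasible under the smaller capacities, both networks have
  the same maximum value.\<close>

lemma is_max_flow_subnetwork:
  assumes f: "is_max_flow G c x y f" "is_flow G c' x y f"
    and le: "\<And>e. e \<in> arcs G \<Longrightarrow> c' e \<le> c e"
  shows "is_max_flow G c' x y g \<longleftrightarrow> is_max_flow G c x y g \<and> is_flow G c' x y g"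
proof -
  have "is_flow G c x y h" if "is_flow G c' x y h" for h
    using is_flow_mono_cap[OF that le] .
  then show ?thesis using f unfolding is_max_flow_def by (meson order_trans)
qed

section \<open>The network of the game\<close>

lemma verts_arcs_game_graph:
  "Bat_Node b t \<in> verts (game_graph I) \<longleftrightarrow> b \<in> agents I \<and> t \<in> {1..steps I}"
  "Source_Arc t v \<in> arcs (game_graph I) \<longleftrightarrow> t \<in> {1..steps I} \<and> v \<in> pverts (base_graph I)"
  "Target_Arc t v \<in> arcs (game_graph I) \<longleftrightarrow> t \<in> {1..steps I} \<and> v \<in> pverts (base_graph I)"
  "Grid_Arc t e \<in> arcs (game_graph I) \<longleftrightarrow> t \<in> {1..steps I} \<and> e \<in> parcs (base_graph I)"
  "Bat_Arc b t \<in> arcs (game_graph I) \<longleftrightarrow> b \<in> agents I \<and> t \<in> {1..<steps I}"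
  "Charge_Arc b t \<in> arcs (game_graph I) \<longleftrightarrow> b \<in> agents I \<and> t \<in> {1..steps I}"
  "Discharge_Arc b t \<in> arcs (game_graph I) \<longleftrightarrow> b \<in> agents I \<and> t \<in> {1..steps I}"
  by (auto simp: game_graph_def simp del: split_paired_Ex)

lemma finite_arcs_game_graph:
  fixes I :: "('v, 'b) battery_inst"
  assumes "battery_instance I"
  shows "finite (arcs (game_graph I))"
proof -
  interpret pair_fin_digraph "base_graph I" using assms by (simp add: battery_instance_def)
  have "finite (agents I)" using assms by (simp add: battery_instance_def)
  then have "finite ((\<lambda>(t, v). Source_Arc t v :: ('v, 'b) arc) ` ({1..steps I} \<times> pverts (base_graph I))
      \<union> (\<lambda>(t, v). Target_Arc t v) ` ({1..steps I} \<times> pverts (base_graph I))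
      \<union> (\<lambda>(t, e). Grid_Arc t e) ` ({1..steps I} \<times> parcs (base_graph I))
      \<union> (\<lambda>(b, t). Bat_Arc b t) ` (agents I \<times> {1..<steps I})
      \<union> (\<lambda>(b, t). Charge_Arc b t) ` (agents I \<times> {1..steps I})
      \<union> (\<lambda>(b, t). Discharge_Arc b t) ` (agents I \<times> {1..steps I}))" (is "finite ?A")
    by simp
  moreover have "arcs (game_graph I) \<subseteq> ?A" by (auto simp: game_graph_def image_iff)
  ultimately show ?thesis by (rule finite_subset[rotated])
qed

text \<open>Conservation at the two battery nodes of \<open>b\<close>: \<open>Bat_Arc b 1\<close> is
  the only battery arc, leaving the first node and entering the second.\<close>

lemma battery_conservation:
  assumes "steps I = 2" "b \<in> agents I" "is_flow (game_graph I) c Source Target f"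
  shows "f (Charge_Arc b 1) = f (Discharge_Arc b 1) + f (Bat_Arc b 1)"
    and "f (Bat_Arc b 1) + f (Charge_Arc b 2) = f (Discharge_Arc b 2)"
proof -
  let ?G = "game_graph I"
  have th: "tail ?G = game_tail I" "head ?G = game_head I" by (simp_all add: game_graph_def)
  have eqs: "in_arcs ?G (Bat_Node b 1) = {Charge_Arc b 1}"
    "out_arcs ?G (Bat_Node b 1) = {Discharge_Arc b 1, Bat_Arc b 1}"
    "in_arcs ?G (Bat_Node b 2) = {Bat_Arc b 1, Charge_Arc b 2}"
    "out_arcs ?G (Bat_Node b 2) = {Discharge_Arc b 2}"
    using assms(1,2) unfolding in_arcs_def out_arcs_def th
    by (auto simp: verts_arcs_game_graph elim!: game_head.elims game_tail.elims)
  have "sum f (in_arcs ?G (Bat_Node b t)) = sum f (out_arcs ?G (Bat_Node b t))" if "t \<in> {1, 2}" for t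
    using assms that by (auto simp: is_flow_def verts_arcs_game_graph)
  from this[of 1] this[of 2] show "f (Charge_Arc b 1) = f (Discharge_Arc b 1) + f (Bat_Arc b 1)"
    "f (Bat_Arc b 1) + f (Charge_Arc b 2) = f (Discharge_Arc b 2)"
    unfolding eqs by simp_all
qed

text \<open>Only transaction arcs are infinite under \<open>base_cap\<close>, and a profile
  overrides exactly those. This supplies the real capacities that compactness requires.\<close>

lemma profile_cap_real_nonneg:
  assumes "battery_instance I" "e \<in> arcs (game_graph I)"
  shows "profile_cap I s e = ereal (real_of_ereal (profile_cap I s e))"
    and "0 \<le> real_of_ereal (profile_cap I s e)"
  using assms
  by (cases e; simp add: battery_instance_def verts_arcs_game_graph ereal_max[symmetric]
      del: ereal_max)+

lemma game_min_cost_max_flow_exists: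
  assumes "battery_instance I"
  obtains f where "is_max_flow (game_graph I) (profile_cap I s) Source Target f"
    and "\<And>g. is_max_flow (game_graph I) (profile_cap I s) Source Target g \<Longrightarrow>
      (\<Sum>e\<in>arcs (game_graph I). w e * f e) \<le> (\<Sum>e\<in>arcs (game_graph I). w e * g e)"
  using min_cost_max_flow_exists[of "game_graph I" "profile_cap I s"
      "\<lambda>e. real_of_ereal (profile_cap I s e)" Source Target w]
    profile_cap_real_nonneg[OF assms, of _ s] by blast

section \<open>Strategies and utilities for two time steps\<close>

lemma is_strategy_two_steps:
  assumes "steps I = 2"
  shows "is_strategy I b sb \<longleftrightarrow> 0 \<le> sb 1 \<and> sb 1 \<le> bat_cap I b 1"
proof -
  have "{1..<2::nat} = {1}" by auto
  then show ?thesis by (simp add: is_strategy_def assms)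
qed

text \<open>A maximum flow exists and saturates the transaction arcs of \<open>b\<close>, so adding
  the two conservation equations of the battery yields \<open>s b 1 + s b 2 = 0\<close>.\<close>

lemma admissible_discharge_eq:
  assumes "battery_instance I" "steps I = 2" "b \<in> agents I"
    and "is_strategy I b (s b)" "admissible_for I s b"
  shows "s b 2 = - s b 1"
proof -
  obtain f where f: "is_max_flow (game_graph I) (profile_cap I s) Source Target f"
    using game_min_cost_max_flow_exists[OF assms(1)] by blast
  have "f (Charge_Arc b t) = max 0 (s b t) \<and> f (Discharge_Arc b t) = max 0 (- s b t)"
    if "t \<in> {1, 2}" for t
    using assms(2,5) that f by (auto simp: admissible_for_def admissible_arc_def simp del: ereal_max)
  from this[of 1] this[of 2] show ?thesis
    using battery_conservation[OF assms(2,3), of "profile_cap I s" f] f assms(2,4)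
    by (auto simp: is_max_flow_def is_strategy_two_steps max_def split: if_splits)
qed

lemma utility_two_steps:
  assumes "battery_instance I" "steps I = 2" "b \<in> agents I"
    and "is_strategy I b (s b)" "admissible_for I s b"
  shows "utility I s p b = ereal (s b 1 * (p 2 - p 1))"
  using admissible_discharge_eq[OF assms] assms(2,5)
  by (simp add: utility_def numeral_2_eq_2 algebra_simps)

text \<open>A strictly better deviation has utility above minus infinity, hence is admissible and
  balanced; only the amounts of step 1 remain to be compared.\<close>

lemma nash_equilibrium_two_steps:
  assumes "battery_instance I" "steps I = 2" "is_profile I s"
    and adm: "\<And>b. b \<in> agents I \<Longrightarrow> admissible_for I s b"
    and dev: "\<And>b s'. \<lbrakk>b \<in> agents I; is_strategy I b s'; s' 2 = - s' 1; admissible_for I (s(b := s')) b\<rbrakk>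
      \<Longrightarrow> s' 1 * (p 2 - p 1) \<le> s b 1 * (p 2 - p 1)"
  shows "nash_equilibrium I p s"
  unfolding nash_equilibrium_def
proof (intro conjI assms(3) notI, elim bexE exE conjE)
  fix b s' assume b: "b \<in> agents I" "is_strategy I b s'"
    and gt: "utility I (s(b := s')) p b > utility I s p b"
  have adm': "admissible_for I (s(b := s')) b"
    using gt by (auto simp: utility_def split: if_splits)
  have "s' 2 = - s' 1"
    using admissible_discharge_eq[OF assms(1,2) b(1) _ adm'] b by simp
  moreover have "is_strategy I b (s b)" using assms(3) b by (simp add: is_profile_def)
  ultimately show False
    using dev[OF b _ adm'] gt utility_two_steps[OF assms(1,2) b(1)] adm[OF b(1)] adm' b(2)
    by (simp add: not_le)
qed

section \<open>Equilibria for falling and for rising prices\<close>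

lemma zero_profile_nash:
  assumes I: "battery_instance I" "steps I = 2" and "p 2 \<le> p 1"
  shows "nash_equilibrium I p (\<lambda>_ _. 0)"
proof (rule nash_equilibrium_two_steps[OF I])
  show "is_profile I (\<lambda>_ _. 0)"
    using I by (simp add: is_profile_def is_strategy_two_steps battery_instance_def)
next
  fix b assume b: "b \<in> agents I"
  have "f (Charge_Arc b t) = 0 \<and> f (Discharge_Arc b t) = 0"
    if f: "is_max_flow (game_graph I) (profile_cap I (\<lambda>_ _. 0)) Source Target f"
      and t: "t \<in> {1..steps I}" for f t
  proof -
    have "0 \<le> f e \<and> ereal (f e) \<le> profile_cap I (\<lambda>_ _. 0) e" if "e \<in> arcs (game_graph I)" for e
      using f that by (simp add: is_max_flow_def is_flow_def)
    from this[of "Charge_Arc b t"] this[of "Discharge_Arc b t"] show ?thesis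
      using b t by (simp add: verts_arcs_game_graph)
  qed
  then show "admissible_for I (\<lambda>_ _. 0) b"
    by (simp add: admissible_for_def admissible_arc_def)
next
  fix b s' assume "is_strategy I b s'"
  with I(2) assms(3) show "s' 1 * (p 2 - p 1) \<le> 0 * (p 2 - p 1)"
    by (simp add: is_strategy_two_steps mult_nonneg_nonpos)
qed

text \<open>By \<open>admissible_discharge_eq\<close>, admissible strategies have this form at times
  1 and 2, so one number per agent describes them.\<close>

definition shift_profile :: "('b \<Rightarrow> real) \<Rightarrow> 'b profile" where
  "shift_profile a b t = (if t = 1 then a b else - a b)"

text \<open>Charging in step 2 and discharging in step 1 have capacity 0, so conservation forces a
  single amount along the path through the battery.\<close>

lemma flow_shift_profile:
  assumes "steps I = 2" "b \<in> agents I" "0 \<le> a b"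
    and "is_flow (game_graph I) (profile_cap I (shift_profile a)) Source Target f"
  shows "f (Charge_Arc b 2) = 0" "f (Discharge_Arc b 1) = 0"
    and "f (Bat_Arc b 1) = f (Charge_Arc b 1)" "f (Discharge_Arc b 2) = f (Charge_Arc b 1)"
    and "0 \<le> f (Charge_Arc b 1)" "f (Charge_Arc b 1) \<le> a b"
proof -
  have 1: "0 \<le> f e \<and> ereal (f e) \<le> profile_cap I (shift_profile a) e"
    if "e \<in> arcs (game_graph I)" for e
    using assms(4) that by (simp add: is_flow_def)
  show 2: "f (Charge_Arc b 2) = 0" "f (Discharge_Arc b 1) = 0"
    and "0 \<le> f (Charge_Arc b 1)" "f (Charge_Arc b 1) \<le> a b"
    using 1[of "Charge_Arc b 2"] 1[of "Discharge_Arc b 1"] 1[of "Charge_Arc b 1"] assms(1-3)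
    by (simp_all add: shift_profile_def verts_arcs_game_graph)
  show "f (Bat_Arc b 1) = f (Charge_Arc b 1)" "f (Discharge_Arc b 2) = f (Charge_Arc b 1)"
    using battery_conservation[OF assms(1,2,4)] 2 by simp_all
qed

lemma least_battery_flow_nash:
  assumes I: "battery_instance I" "steps I = 2" and p: "p 1 < p 2"
  shows "\<exists>s :: 'b profile. nash_equilibrium (I :: ('v, 'b) battery_inst) p s"
proof -
  let ?G = "game_graph I"
  let ?cap = "\<lambda>a. profile_cap I (shift_profile a)"
  let ?max = "\<lambda>c. is_max_flow ?G c Source Target"
  define k where "k b = bat_cap I b 1" for b
  \<comment> \<open>Weighting the arcs by the indicator of \<open>C\<close> makes the cost of a flow
    the total amount moved through the batteries.\<close>
  define C where "C = (\<lambda>b. Charge_Arc b 1 :: ('v, 'b) arc) ` agents I"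
  have C: "C \<subseteq> arcs ?G" using I(2) by (auto simp: C_def verts_arcs_game_graph)
  have k: "0 \<le> k b" if "b \<in> agents I" for b
    using I that by (simp add: k_def battery_instance_def)
  obtain f where f: "?max (?cap k) f" and "\<And>g. ?max (?cap k) g \<Longrightarrow>
      (\<Sum>e\<in>arcs ?G. of_bool (e \<in> C) * f e) \<le> (\<Sum>e\<in>arcs ?G. of_bool (e \<in> C) * g e)"
    using game_min_cost_max_flow_exists[OF I(1), of "shift_profile k" "\<lambda>e. of_bool (e \<in> C)"]
    by blast
  moreover have "(\<Sum>e\<in>arcs ?G. of_bool (e \<in> C) * g e) = (\<Sum>b\<in>agents I. g (Charge_Arc b 1))" for g :: "_ \<Rightarrow> real"
  proof -
    have "(\<Sum>e\<in>arcs ?G. of_bool (e \<in> C) * g e) = sum g C"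
      using finite_arcs_game_graph[OF I(1)] C
      by (simp add: of_bool_def if_distrib[of "\<lambda>z. z * _"] sum.If_cases Int_absorb1)
    also have "\<dots> = (\<Sum>b\<in>agents I. g (Charge_Arc b 1))"
      unfolding C_def by (subst sum.reindex) (auto simp: inj_on_def)
    finally show ?thesis .
  qed
  ultimately have f_least: "(\<Sum>b\<in>agents I. f (Charge_Arc b 1)) \<le> (\<Sum>b\<in>agents I. g (Charge_Arc b 1))"
    if "?max (?cap k) g" for g using that by simp
  have f_flow: "is_flow ?G (?cap k) Source Target f" using f by (simp add: is_max_flow_def)
  note f_arc = flow_shift_profile[OF I(2) _ k f_flow]
  \<comment> \<open>Offers between what \<open>f\<close> uses and full capacity keep
    \<open>f\<close> feasible. This serves both for the equilibrium itself and for deviations to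
    larger offers.\<close>
  have sub: "?max (?cap a') g \<longleftrightarrow> ?max (?cap k) g \<and> is_flow ?G (?cap a') Source Target g"
    "is_flow ?G (?cap a') Source Target f"
    if "\<And>b. b \<in> agents I \<Longrightarrow> f (Charge_Arc b 1) \<le> a' b \<and> a' b \<le> k b" for a' g
  proof -
    show flow: "is_flow ?G (?cap a') Source Target f"
      unfolding is_flow_def
    proof (intro conjI ballI)
      fix e assume e: "e \<in> arcs ?G"
      then have "ereal (f e) \<le> ?cap k e" using f_flow by (simp add: is_flow_def)
      then show "ereal (f e) \<le> ?cap a' e"
        using e f_arc that I(2)
        by (cases e) (auto simp: verts_arcs_game_graph shift_profile_def
            le_Suc_eq numeral_2_eq_2 le_max_iff_disj)
    qed (use f_flow in \<open>auto simp: is_flow_def\<close>)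
    have "0 \<le> a' b \<and> a' b \<le> k b" if "b \<in> agents I" for b
      using \<open>\<And>b. b \<in> agents I \<Longrightarrow> f (Charge_Arc b 1) \<le> a' b \<and> a' b \<le> k b\<close>[OF that]
        f_arc(5)[OF that that] by linarith
    then have "?cap a' e \<le> ?cap k e" if "e \<in> arcs ?G" for e
      using that k by (cases e) (auto simp: verts_arcs_game_graph shift_profile_def)
    then show "?max (?cap a') g \<longleftrightarrow> ?max (?cap k) g \<and> is_flow ?G (?cap a') Source Target g"
      by (rule is_max_flow_subnetwork[OF f flow])
  qed
  define a where "a b = f (Charge_Arc b 1)" for b
  have "nash_equilibrium I p (shift_profile a)"
  proof (rule nash_equilibrium_two_steps[OF I])
    show "is_profile I (shift_profile a)"
      using f_arc(5,6) I(2)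
      by (simp add: is_profile_def is_strategy_two_steps shift_profile_def a_def k_def)
  next
    fix b assume b: "b \<in> agents I"
    have "g (Charge_Arc b 1) = a b" "is_flow ?G (?cap a) Source Target g" if "?max (?cap a) g" for g
    proof -
      have g: "?max (?cap k) g" "is_flow ?G (?cap a) Source Target g"
        using sub(1)[of a g] that f_arc(6) by (auto simp: a_def)
      have le: "g (Charge_Arc b 1) \<le> a b" if "b \<in> agents I" for b
        using flow_shift_profile(6)[OF I(2) that _ g(2)] f_arc(5)[OF that that] by (simp add: a_def)
      \<comment> \<open>Each term is at most \<open>a b\<close>, while minimality of
        \<open>f\<close> bounds the sum from below; equal sums then force equality in every
        term.\<close>
      have "(\<Sum>b\<in>agents I. g (Charge_Arc b 1)) = sum a (agents I)"
        by (rule antisym[OF sum_mono[OF le]]) (use f_least[OF g(1)] in \<open>simp_all add: a_def\<close>)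
      from sum_mono_inv[OF this le b] show "g (Charge_Arc b 1) = a b"
        using I(1) by (simp add: battery_instance_def)
      show "is_flow ?G (?cap a) Source Target g" by (fact g(2))
    qed
    moreover have "0 \<le> a b" using f_arc(5) b by (simp add: a_def)
    moreover have "{1..steps I} = {1, 2}" using I(2) by auto
    ultimately show "admissible_for I (shift_profile a) b"
      using flow_shift_profile[OF I(2) b, of a]
      by (auto simp: admissible_for_def admissible_arc_def shift_profile_def)
  next
    fix b s' assume b: "b \<in> agents I" and s': "is_strategy I b s'" "s' 2 = - s' 1"
      and adm: "admissible_for I ((shift_profile a)(b := s')) b"
    have "s' 1 \<le> a b"
    proof (rule ccontr)
      assume gt: "\<not> s' 1 \<le> a b"
      let ?a' = "a(b := s' 1)"
      \<comment> \<open>The deviation is again a shift profile at times 1 and 2, so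
        \<open>sub\<close> applies to it; elsewhere the two profiles may differ.\<close>
      have cap: "profile_cap I ((shift_profile a)(b := s')) e = ?cap ?a' e" if "e \<in> arcs ?G" for e
        using that s'(2) I(2)
        by (cases e) (auto simp: shift_profile_def verts_arcs_game_graph le_Suc_eq numeral_2_eq_2)
      have "f (Charge_Arc b' 1) \<le> ?a' b' \<and> ?a' b' \<le> k b'" if "b' \<in> agents I" for b'
        using gt s'(1) f_arc(6) that I(2) by (auto simp: a_def k_def is_strategy_two_steps)
      then have "?max (?cap ?a') f" using sub(1)[of ?a' f] sub(2)[of ?a'] f by blast
      then have "?max (profile_cap I ((shift_profile a)(b := s'))) f"
        by (simp add: is_max_flow_def is_flow_def cap)
      \<comment> \<open>Admissibility of the deviation demands that \<open>f\<close> saturate the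
        larger offer, but \<open>f\<close> charges only \<open>a b\<close>.\<close>
      then have "f (Charge_Arc b 1) = max 0 (s' 1)"
        using adm I(2) by (simp add: admissible_for_def admissible_arc_def del: ereal_max)
      with gt show False by (auto simp: a_def)
    qed
    with p show "s' 1 * (p 2 - p 1) \<le> shift_profile a b 1 * (p 2 - p 1)"
      by (simp add: shift_profile_def mult_right_mono)
  qed
  then show ?thesis by blast
qed

theorem theorem2:
  fixes I :: "('v, 'b) battery_inst" and p :: prices
  assumes "battery_instance I"
    and "steps I = 2"
  shows "\<exists>s :: 'b profile. nash_equilibrium I p s"
proof (cases "p 2 \<le> p 1")
  case True
  then show ?thesis using zero_profile_nash[OF assms] by blast
next
  case False
  then show ?thesis using least_battery_flow_nash[OF assms] by simp
qed

end
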